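(* Let $\Gamma$ be a non-trivial strongly regular graph on $n$ vertices and let $f\in\mathrm{End}(\Gamma)$ be a proper endomorphism of $\Gamma$ (i.e. not an automorphism) of rank $r$. Then $n-r\ge 1+\frac{\sqrt{n-1}}{12}$.
   Context: A finite simple graph is strongly regular with parameters $(n,k,\lambda,\mu)$ if it has $n$ vertices, every vertex has $k$ neighbours, every two adjacent vertices have exactly $\lambda$ common neighbours and every two distinct non-adjacent vertices have exactly $\mu$ common neighbours. It is called non-trivial if both it and its complement are connected (equivalently $\mu>0$ and $k>\mu$). An endomorphism is a map from the vertex set to itself sending edges to edges; its rank is the size of its image. *)

theory Defs
  imports
    Complex_Main
    "Graph_Theory.Digraph_Component"
    "Graph_Theory.Pair_Digraph"
begin

text \<open>
  Finite simple graphs are rendered by the locale \<^locale>\<open>pair_graph\<close>: a finite vertex set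
  \<^const>\<open>pverts\<close> and a symmetric, irreflexive arc relation \<^const>\<open>parcs\<close> on it, each
  edge being present as two opposite arcs.
\<close>

definition neighbours :: "'a pair_pre_digraph \<Rightarrow> 'a \<Rightarrow> 'a set" where
  "neighbours G u = {v. (u, v) \<in> parcs G}"

definition complement_graph :: "'a pair_pre_digraph \<Rightarrow> 'a pair_pre_digraph" where
  "complement_graph G =
     \<lparr> pverts = pverts G,
       parcs = {(u, v). u \<in> pverts G \<and> v \<in> pverts G \<and> u \<noteq> v \<and> (u, v) \<notin> parcs G} \<rparr>"

locale strongly_regular_graph = pair_graph G
  for G :: "'a pair_pre_digraph" and n k l m :: nat +
  assumes card_vertices: "card (pverts G) = n"
    and regular: "u \<in> pverts G \<Longrightarrow> card (neighbours G u) = k"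
    and common_adjacent:
      "(u, v) \<in> parcs G \<Longrightarrow> card (neighbours G u \<inter> neighbours G v) = l"
    and common_nonadjacent:
      "\<lbrakk>u \<in> pverts G; v \<in> pverts G; u \<noteq> v; (u, v) \<notin> parcs G\<rbrakk> \<Longrightarrow>
         card (neighbours G u \<inter> neighbours G v) = m"

text \<open>
  Non-triviality is expressed by connectedness and not by the numerical condition
  \<open>0 < m < k\<close>: the latter is not meaningful for complete graphs, where \<open>m\<close> is
  unconstrained.  The library's \<^const>\<open>connected\<close> includes non-emptiness.
\<close>

locale nontrivial_strongly_regular_graph = strongly_regular_graph G n k l m
  for G :: "'a pair_pre_digraph" and n k l m :: nat +
  assumes connected_graph: "connected (with_proj G)"
    and connected_complement: "connected (with_proj (complement_graph G))"

text \<open>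
  Self-maps of the vertex set are total functions on the vertex type, of which only the values on
  \<^term>\<open>pverts G\<close> matter.
\<close>

definition graph_endomorphism :: "'a pair_pre_digraph \<Rightarrow> ('a \<Rightarrow> 'a) \<Rightarrow> bool" where
  "graph_endomorphism G f \<longleftrightarrow>
     f ` pverts G \<subseteq> pverts G \<and> (\<forall>(u, v) \<in> parcs G. (f u, f v) \<in> parcs G)"

definition graph_automorphism :: "'a pair_pre_digraph \<Rightarrow> ('a \<Rightarrow> 'a) \<Rightarrow> bool" where
  "graph_automorphism G f \<longleftrightarrow>
     bij_betw f (pverts G) (pverts G) \<and>
     (\<forall>u \<in> pverts G. \<forall>v \<in> pverts G. (u, v) \<in> parcs G \<longleftrightarrow> (f u, f v) \<in> parcs G)"

definition proper_endomorphism :: "'a pair_pre_digraph \<Rightarrow> ('a \<Rightarrow> 'a) \<Rightarrow> bool" where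
  "proper_endomorphism G f \<longleftrightarrow> graph_endomorphism G f \<and> \<not> graph_automorphism G f"

definition endomorphism_rank :: "'a pair_pre_digraph \<Rightarrow> ('a \<Rightarrow> 'a) \<Rightarrow> nat" where
  "endomorphism_rank G f = card (f ` pverts G)"

end

theory Submission
  imports Defs
begin

text \<open>
  Write \<open>s = k - m\<close>.  Two facts are combined.

  First, a proper endomorphism \<open>f\<close> identifies two vertices \<open>u \<noteq> v\<close>, which cannot be adjacent.
  Their closed neighbourhoods together contain \<open>2k - m + 2\<close> vertices, and \<open>f\<close> sends all of them
  into the closed neighbourhood of \<open>f u\<close>, which has only \<open>k + 1\<close>.  So the rank drops by at least
  \<open>s + 1\<close> (\<open>rank_loss_at_least\<close>).

  Second, \<open>sqrt (n - 1) \<le> 4 s\<close> in every non-trivial strongly regular graph with more than one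
  vertex (\<open>sqrt_le_four_mul_degree_minus_common\<close>), which is stronger than what is needed.  A small
  \<open>s\<close> means that non-adjacent vertices have nearly the same neighbours.  Let \<open>k'\<close> and \<open>m'\<close> be
  the degree and the non-adjacent parameter of the complement, whose diameter is 2, as is that of
  the graph itself; hence \<open>n - 1\<close> is at most both \<open>k\<^sup>2\<close> and \<open>k'\<^sup>2\<close>.  If \<open>2s \<ge> k\<close>, the first bound
  is enough.  Otherwise \<open>m > k/2\<close>, and counting paths of length two gives \<open>k' < 2k\<close>.  In the
  complement, adjacent vertices have closed neighbourhoods that differ in only \<open>s\<close> vertices each,
  so vertices at distance two still share \<open>m' \<ge> k' + 1 - 2s\<close> neighbours; but the path count
  \<open>k' s = k m'\<close> then forces \<open>2s \<ge> m'\<close>, whence \<open>4s \<ge> k' + 1\<close>.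
\<close>

section \<open>Counting in strongly regular graphs\<close>

context strongly_regular_graph
begin

lemma neighbour_iff: "v \<in> neighbours G u \<longleftrightarrow> (u, v) \<in> parcs G"
  by (simp add: neighbours_def)

lemma arc_sym: "(u, v) \<in> parcs G \<longleftrightarrow> (v, u) \<in> parcs G"
  using pair_sym_arcs by (auto simp: symmetric_def dest: symD)

lemma arc_neq: "(u, v) \<in> parcs G \<Longrightarrow> u \<noteq> v"
  using pair_no_loops by fastforce

lemma neighbours_subset: "neighbours G u \<subseteq> pverts G - {u}"
  by (auto simp: neighbours_def dest: in_arcsD2 arc_neq)

lemma finite_neighbours [simp]: "finite (neighbours G u)"
  using finite_subset[OF neighbours_subset] pair_finite_verts by blast

lemma degree_less:
  assumes "u \<in> pverts G"
  shows "k + 1 \<le> n"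
proof -
  have "card (insert u (neighbours G u)) \<le> card (pverts G)"
    using assms neighbours_subset pair_finite_verts by (intro card_mono) auto
  then show ?thesis
    using assms regular neighbours_subset[of u] card_vertices
    by (simp add: card_insert_if subset_Diff_insert)
qed

lemma card_Un_neighbours:
  assumes "u \<in> pverts G" "v \<in> pverts G"
  shows "card (neighbours G u \<union> neighbours G v)
       + card (neighbours G u \<inter> neighbours G v) = 2 * k"
  using assms regular card_Un_Int[of "neighbours G u" "neighbours G v"] by simp

lemma adjacent_parameter_less:
  assumes "(u, v) \<in> parcs G"
  shows "l + 1 \<le> k"
proof -
  have "card (insert v (neighbours G u \<inter> neighbours G v)) \<le> card (neighbours G u)"
    using assms by (intro card_mono) (auto simp: neighbour_iff)
  moreover have "v \<notin> neighbours G v"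
    by (auto simp: neighbour_iff dest: arc_neq)
  ultimately show ?thesis
    using assms common_adjacent regular in_arcsD1 by simp
qed

lemma nonadjacent_parameter_le:
  assumes "u \<in> pverts G" "v \<in> pverts G" "u \<noteq> v" "(u, v) \<notin> parcs G"
  shows "m \<le> k"
  using assms common_nonadjacent[of u v] regular[of u]
    card_mono[of "neighbours G u" "neighbours G u \<inter> neighbours G v"] by simp

text \<open>
  Both sides count the paths of length two from a fixed vertex \<open>u\<close> to a vertex not adjacent to
  \<open>u\<close>, by the middle vertex on the left and by the end vertex on the right.
\<close>

lemma two_path_count:
  assumes u: "u \<in> pverts G"
  shows "k * (k - (l + 1)) = (n - (k + 1)) * m"
proof -
  let ?N = "neighbours G u" and ?F = "pverts G - insert u (neighbours G u)"
  have fin: "finite ?F"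
    using pair_finite_verts by simp
  have card_F: "card ?F = n - (k + 1)"
    using u neighbours_subset[of u] regular[OF u] card_vertices
    by (subst card_Diff_subset) (auto simp: card_insert_if)
  have end_vertex: "\<forall>w\<in>?F. card {v \<in> ?N. (v, w) \<in> parcs G} = m"
  proof
    fix w assume w: "w \<in> ?F"
    have "{v \<in> ?N. (v, w) \<in> parcs G} = neighbours G u \<inter> neighbours G w"
      using arc_sym by (auto simp: neighbour_iff)
    then show "card {v \<in> ?N. (v, w) \<in> parcs G} = m"
      using w u common_nonadjacent[of u w] by (auto simp: neighbour_iff)
  qed
  have middle_vertex: "card {w \<in> ?F. (v, w) \<in> parcs G} = k - (l + 1)" if v: "v \<in> ?N" for v
  proof -
    have uv: "(u, v) \<in> parcs G" using v by (simp add: neighbour_iff)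
    have "{w \<in> ?F. (v, w) \<in> parcs G}
        = neighbours G v - insert u (neighbours G u \<inter> neighbours G v)"
      by (auto simp: neighbour_iff dest: in_arcsD2)
    also have "card \<dots> = k - (l + 1)"
      using uv arc_sym[of u v] regular[of v] in_arcsD2[OF uv] common_adjacent[OF uv]
        arc_neq[of u u]
      by (subst card_Diff_subset) (auto simp: card_insert_if neighbour_iff)
    finally show ?thesis .
  qed
  have "(\<Sum>v\<in>?N. card {w \<in> ?F. (v, w) \<in> parcs G}) = m * card ?F"
    using fin end_vertex by (intro sum_multicount) auto
  then show ?thesis
    using middle_vertex regular[OF u] card_F by (simp add: mult.commute)
qed

text \<open>
  Let \<open>v\<close> be a common neighbour of the non-adjacent vertices \<open>u\<close> and \<open>w\<close>.  The \<open>l\<close> common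
  neighbours of \<open>v\<close> and \<open>u\<close> and the \<open>l\<close> common neighbours of \<open>v\<close> and \<open>w\<close> all lie among the
  \<open>k - 2\<close> neighbours of \<open>v\<close> other than \<open>u\<close> and \<open>w\<close>, so they overlap; the overlap and \<open>v\<close> itself
  are common neighbours of \<open>u\<close> and \<open>w\<close>.
\<close>

lemma overlap_bound:
  assumes V: "u \<in> pverts G" "w \<in> pverts G" and uw: "u \<noteq> w" "(u, w) \<notin> parcs G"
    and "1 \<le> m"
  shows "2 * l + 3 \<le> k + m"
proof -
  have "neighbours G u \<inter> neighbours G w \<noteq> {}"
    using common_nonadjacent[OF V uw] \<open>1 \<le> m\<close> by auto
  then obtain v where uv: "(u, v) \<in> parcs G" and wv: "(w, v) \<in> parcs G"
    by (auto simp: neighbour_iff)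
  define A where "A = neighbours G u \<inter> neighbours G v"
  define B where "B = neighbours G w \<inter> neighbours G v"
  have fin: "finite A" "finite B"
    by (simp_all add: A_def B_def)
  have cards: "card A = l" "card B = l"
    using common_adjacent uv wv by (simp_all add: A_def B_def)
  have "v \<in> pverts G" using uv by (rule in_arcsD2)
  have "A \<union> B \<subseteq> neighbours G v - {u, w}"
    using uw arc_sym by (auto simp: A_def B_def neighbour_iff dest: arc_neq)
  then have "card (A \<union> B) \<le> card (neighbours G v - {u, w})"
    by (intro card_mono) auto
  also have "\<dots> = k - 2"
    using uv wv uw arc_sym regular[OF \<open>v \<in> pverts G\<close>]
    by (subst card_Diff_subset) (auto simp: neighbour_iff)
  finally have union: "card (A \<union> B) \<le> k - 2" .
  have "card {u, w} \<le> card (neighbours G v)"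
    using uv wv arc_sym by (intro card_mono) (auto simp: neighbour_iff)
  then have "2 \<le> k"
    using uw regular[OF \<open>v \<in> pverts G\<close>] by simp
  have "card (insert v (A \<inter> B)) \<le> card (neighbours G u \<inter> neighbours G w)"
    using uv wv by (intro card_mono) (auto simp: A_def B_def neighbour_iff)
  moreover have "v \<notin> A \<inter> B"
    by (auto simp: A_def neighbour_iff dest: arc_neq)
  ultimately have "card (A \<inter> B) + 1 \<le> m"
    using fin common_nonadjacent[OF V uw] by simp
  then show ?thesis
    using union card_Un_Int[OF fin] cards \<open>2 \<le> k\<close> by linarith
qed

text \<open>
  If non-adjacent vertices had no common neighbour, adjacency-or-equality would be transitive, and
  a connected graph would be complete.
\<close>

lemma connected_imp_common_neighbour:
  assumes conn: "connected (with_proj G)"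
    and uv: "u \<in> pverts G" "v \<in> pverts G" "u \<noteq> v" "(u, v) \<notin> parcs G"
  shows "1 \<le> m"
proof (rule ccontr)
  assume "\<not> 1 \<le> m"
  then have m0: "m = 0" by simp
  have trans: "a = c \<or> (a, c) \<in> parcs G"
    if ab: "(a, b) \<in> parcs G" and bc: "(b, c) \<in> parcs G" for a b c
  proof (rule ccontr)
    assume neg: "\<not> (a = c \<or> (a, c) \<in> parcs G)"
    have "card (neighbours G a \<inter> neighbours G c) = 0"
      using common_nonadjacent[of a c] in_arcsD1[OF ab] in_arcsD2[OF bc] neg m0 by simp
    moreover have "b \<in> neighbours G a \<inter> neighbours G c"
      using ab bc arc_sym by (auto simp: neighbour_iff)
    ultimately show False by auto
  qed
  have "(parcs G)\<^sup>s = parcs G"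
    using arc_sym by (auto simp: symcl_def)
  then have "(u, v) \<in> rtrancl_on (pverts G) (parcs G)"
    using conn uv unfolding connected_conv by auto
  then have "u = v \<or> (u, v) \<in> parcs G"
    by (induction rule: rtrancl_on_induct) (use trans in blast)+
  then show False using uv by simp
qed

end

section \<open>Complements\<close>

lemma pverts_complement [simp]: "pverts (complement_graph G) = pverts G"
  by (simp add: complement_graph_def)

lemma parcs_complement:
  "(u, v) \<in> parcs (complement_graph G) \<longleftrightarrow>
     u \<in> pverts G \<and> v \<in> pverts G \<and> u \<noteq> v \<and> (u, v) \<notin> parcs G"
  by (simp add: complement_graph_def)

lemma neighbours_complement:
  "u \<in> pverts G \<Longrightarrow> neighbours (complement_graph G) u = pverts G - insert u (neighbours G u)"
  by (auto simp: neighbours_def parcs_complement)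

context strongly_regular_graph
begin

lemma complement_strongly_regular:
  "strongly_regular_graph (complement_graph G) n (n - (k + 1)) (n + m - (2 * k + 2)) (n + l - 2 * k)"
proof
  let ?H = "complement_graph G"
  show "finite (parcs ?H)"
    using pair_finite_verts
    by (intro finite_subset[of "parcs ?H" "pverts G \<times> pverts G"]) (auto simp: parcs_complement)
  show "symmetric ?H"
    using arc_sym by (auto simp: symmetric_def parcs_complement intro!: symI)
  have common: "card (neighbours ?H u \<inter> neighbours ?H v)
      = n - card ({u, v} \<union> (neighbours G u \<union> neighbours G v))"
    if "u \<in> pverts G" "v \<in> pverts G" for u v
  proof -
    have "neighbours ?H u \<inter> neighbours ?H v
        = pverts G - ({u, v} \<union> (neighbours G u \<union> neighbours G v))"
      using that by (auto simp: neighbours_complement)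
    then show ?thesis
      using that neighbours_subset[of u] neighbours_subset[of v] card_vertices
      by (simp, subst card_Diff_subset) auto
  qed
  show "card (neighbours ?H u) = n - (k + 1)" if "u \<in> pverts ?H" for u
    using that neighbours_subset[of u] regular[of u] card_vertices
    by (subst neighbours_complement, simp, subst card_Diff_subset) (auto simp: card_insert_if)
  show "card (neighbours ?H u \<inter> neighbours ?H v) = n + m - (2 * k + 2)"
    if "(u, v) \<in> parcs ?H" for u v
  proof -
    have uv: "u \<in> pverts G" "v \<in> pverts G" "u \<noteq> v" "(u, v) \<notin> parcs G"
      using that by (auto simp: parcs_complement)
    have "{u, v} \<inter> (neighbours G u \<union> neighbours G v) = {}"
      using uv arc_sym by (auto simp: neighbour_iff dest: arc_neq)
    then have "card ({u, v} \<union> (neighbours G u \<union> neighbours G v))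
        = 2 + card (neighbours G u \<union> neighbours G v)"
      using uv by (subst card_Un_disjoint) auto
    then show ?thesis
      using common[of u v] uv card_Un_neighbours[of u v] common_nonadjacent[OF uv] by simp
  qed
  show "card (neighbours ?H u \<inter> neighbours ?H v) = n + l - 2 * k"
    if "u \<in> pverts ?H" "v \<in> pverts ?H" "u \<noteq> v" "(u, v) \<notin> parcs ?H" for u v
  proof -
    have V: "u \<in> pverts G" "v \<in> pverts G" and uv: "(u, v) \<in> parcs G"
      using that by (auto simp: parcs_complement)
    have "{u, v} \<union> (neighbours G u \<union> neighbours G v) = neighbours G u \<union> neighbours G v"
      using uv arc_sym by (auto simp: neighbour_iff)
    then show ?thesis
      using common[OF V] card_Un_neighbours[OF V] common_adjacent[OF uv] by simp
  qed
qed (use pair_finite_verts card_vertices in \<open>auto simp: parcs_complement\<close>)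

end

section \<open>The gap between the degree and the non-adjacent parameter\<close>

text \<open>
  Here \<open>s\<close> stands for \<open>k - m\<close>, and \<open>k'\<close>, \<open>m'\<close> are the parameters of the complement.  The
  hypotheses are the path counts in the graph and in its complement and the overlap bound in the
  complement.
\<close>

lemma sum_of_degrees_bound:
  fixes k k' m m' s :: real
  assumes "1 \<le> m" "1 \<le> m'" "0 < k" "0 < k'" "0 \<le> s"
    and s: "s = k - m"
    and paths: "k' * m \<le> k * (k - 1)"
    and paths': "k * m' \<le> k' * (k' - 1)" "k' * s = k * m'"
    and overlap: "k' + 1 \<le> m' + 2 * s"
  shows "k + k' \<le> (4 * s)\<^sup>2"
proof (cases "k \<le> 2 * s")
  case True
  have "k' * 1 \<le> k' * m"
    using assms by (intro mult_left_mono) auto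
  then have "k + k' \<le> k\<^sup>2"
    using paths by (simp add: power2_eq_square algebra_simps)
  also have "\<dots> \<le> (4 * s)\<^sup>2"
    using True assms by (intro power_mono) auto
  finally show ?thesis .
next
  case False
  have "k * 1 \<le> k * m'"
    using assms by (intro mult_left_mono) auto
  then have bound: "k + k' \<le> k'\<^sup>2"
    using paths' by (simp add: power2_eq_square algebra_simps)
  have "k' * (k / 2) \<le> k' * m"
    using False s assms by (intro mult_left_mono) auto
  also have "\<dots> \<le> k * k"
    using paths \<open>0 < k\<close> by (simp add: algebra_simps)
  finally have "k * k' \<le> k * (2 * k)"
    by (simp add: mult.commute)
  then have "k' \<le> 2 * k"
    using \<open>0 < k\<close> by simp
  then have "k' * m' \<le> (2 * k) * m'"
    using assms by (intro mult_right_mono) auto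
  also have "\<dots> = k' * (2 * s)"
    using paths'(2) by simp
  finally have "m' \<le> 2 * s"
    using \<open>0 < k'\<close> by simp
  then have "k' \<le> 4 * s"
    using overlap by simp
  then have "k'\<^sup>2 \<le> (4 * s)\<^sup>2"
    using assms by (intro power_mono) auto
  then show ?thesis using bound by simp
qed

text \<open>
  A pair of distinct non-adjacent vertices is what excludes the one-vertex graph; in a connected
  graph it also provides an edge, and so the same situation in the complement.
\<close>

lemma (in nontrivial_strongly_regular_graph) sqrt_le_four_mul_degree_minus_common:
  assumes u: "u \<in> pverts G" and v: "v \<in> pverts G" and "u \<noteq> v" "(u, v) \<notin> parcs G"
  shows "sqrt (real n - 1) \<le> 4 * (real k - real m)"
proof -
  define k' where "k' = n - (k + 1)"
  define l' where "l' = n + m - (2 * k + 2)"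
  define m' where "m' = n + l - 2 * k"
  interpret H: strongly_regular_graph "complement_graph G" n k' l' m'
    unfolding k'_def l'_def m'_def by (rule complement_strongly_regular)
  note nonadj = assms
  have m1: "1 \<le> m"
    using connected_imp_common_neighbour[OF connected_graph nonadj] .
  then have "neighbours G u \<inter> neighbours G v \<noteq> {}"
    using common_nonadjacent[OF nonadj] by auto
  then obtain w where uw: "(u, w) \<in> parcs G"
    by (auto simp: neighbour_iff)
  have nonadj': "u \<in> pverts (complement_graph G)" "w \<in> pverts (complement_graph G)"
      "u \<noteq> w" "(u, w) \<notin> parcs (complement_graph G)"
    using uw in_arcsD1 in_arcsD2 arc_neq by (auto simp: parcs_complement)
  have m'1: "1 \<le> m'"
    using H.connected_imp_common_neighbour[OF connected_complement nonadj'] .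
  have "(u, v) \<in> parcs (complement_graph G)"
    using nonadj by (simp add: parcs_complement)
  then have l'1: "l' + 1 \<le> k'"
    by (rule H.adjacent_parameter_less)
  have l1: "l + 1 \<le> k"
    using uw by (rule adjacent_parameter_less)
  have kn: "k + 1 \<le> n" "m \<le> k"
    using degree_less[OF u] nonadjacent_parameter_le[OF nonadj] by auto
  \<comment> \<open>The truncated difference defining \<open>l'\<close> is exact: two non-adjacent vertices and their
      neighbours are \<open>2k - m + 2\<close> distinct vertices.\<close>
  have "2 * k + 2 \<le> n + m"
  proof -
    have "card ({u, v} \<union> (neighbours G u \<union> neighbours G v)) \<le> n"
      using u v neighbours_subset pair_finite_verts
      by (intro card_mono[of "pverts G", simplified card_vertices]) auto
    moreover have "{u, v} \<inter> (neighbours G u \<union> neighbours G v) = {}"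
      using nonadj arc_sym by (auto simp: neighbour_iff dest: arc_neq)
    ultimately show ?thesis
      using nonadj card_Un_neighbours[OF u v] common_nonadjacent[OF nonadj]
        card_Un_disjoint[of "{u, v}" "neighbours G u \<union> neighbours G v"] by simp
  qed
  then have l'_eq: "k' - (l' + 1) = k - m" and k'_eq: "n - (k' + 1) = k"
    using kn by (auto simp: k'_def l'_def)
  have paths: "k * (k - (l + 1)) = k' * m"
    using two_path_count[OF u] by (simp add: k'_def)
  have paths': "k' * (k - m) = k * m'"
    using H.two_path_count[of u] u l'_eq k'_eq by simp
  have overlap: "2 * l' + 3 \<le> k' + m'"
    using H.overlap_bound[OF nonadj' m'1] .
  have "k' * m \<le> k * (k - 1)" "k * m' \<le> k' * (k' - 1)"
    unfolding paths[symmetric] paths'[symmetric] using l'_eq by (auto intro!: mult_le_mono)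
  then have "real (k' * m) \<le> real (k * (k - 1))" "real (k * m') \<le> real (k' * (k' - 1))"
    by (simp_all only: of_nat_le_iff)
  moreover have "real (k' * (k - m)) = real (k * m')"
    using paths' by simp
  moreover have "real k' + 1 \<le> real m' + 2 * (real k - real m)"
  proof -
    have "k' + 1 + 2 * m \<le> m' + 2 * k"
      using overlap l'_eq l'1 kn by linarith
    then show ?thesis by simp
  qed
  ultimately have "real k + real k' \<le> (4 * (real k - real m))\<^sup>2"
    using m1 m'1 l1 l'1 kn
    by (intro sum_of_degrees_bound[of "real m" "real m'" "real k" "real k'" "real k - real m"])
      (auto simp: of_nat_diff)
  moreover have "real k + real k' = real n - 1"
    using kn by (simp add: k'_def of_nat_diff)
  ultimately show ?thesis
    using kn by (intro real_le_lsqrt) auto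
qed

section \<open>Rank loss of proper endomorphisms\<close>

lemma card_minus_card_image_mono:
  assumes "finite A" "S \<subseteq> A"
  shows "card S + card (f ` A) \<le> card A + card (f ` S)"
proof -
  have "f ` A = f ` S \<union> f ` (A - S)"
    using assms by auto
  then have "card (f ` A) \<le> card (f ` S) + card (f ` (A - S))"
    by (simp add: card_Un_le)
  also have "card (f ` (A - S)) \<le> card A - card S"
    using assms card_image_le[of "A - S" f] by (simp add: card_Diff_subset finite_subset)
  finally show ?thesis
    using card_mono[OF assms] by linarith
qed

context strongly_regular_graph
begin

text \<open>
  An injective endomorphism permutes the finite set of arcs, so it also reflects adjacency.
\<close>

lemma proper_endomorphism_not_inj:
  assumes "proper_endomorphism G f"
  shows "\<not> inj_on f (pverts G)"
proof
  assume inj: "inj_on f (pverts G)"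
  have sub: "f ` pverts G \<subseteq> pverts G"
    and arcs: "map_prod f f ` parcs G \<subseteq> parcs G"
    using assms by (auto simp: proper_endomorphism_def graph_endomorphism_def)
  have "inj_on (map_prod f f) (parcs G)"
    by (rule inj_on_subset[OF map_prod_inj_on[OF inj inj]]) (auto dest: in_arcsD1 in_arcsD2)
  then have surj: "map_prod f f ` parcs G = parcs G"
    using endo_inj_surj[OF pair_finite_arcs arcs] by blast
  have "(u, v) \<in> parcs G" if uv: "u \<in> pverts G" "v \<in> pverts G" "(f u, f v) \<in> parcs G" for u v
  proof -
    obtain a b where ab: "(a, b) \<in> parcs G" "f u = f a" "f v = f b"
      using uv(3) surj by (force simp: image_iff)
    then show ?thesis
      using uv inj in_arcsD1 in_arcsD2 by (metis inj_onD)
  qed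
  moreover have "bij_betw f (pverts G) (pverts G)"
    using inj endo_inj_surj[OF pair_finite_verts sub inj] by (simp add: bij_betw_def)
  ultimately have "graph_automorphism G f"
    using arcs by (auto simp: graph_automorphism_def)
  then show False
    using assms by (simp add: proper_endomorphism_def)
qed

lemma rank_loss_at_least:
  assumes endo: "graph_endomorphism G f"
    and V: "u \<in> pverts G" "v \<in> pverts G" and "u \<noteq> v" and "f u = f v"
  shows "k + 1 + endomorphism_rank G f \<le> n + m" and "(u, v) \<notin> parcs G"
proof -
  have arc: "(f a, f b) \<in> parcs G" if "(a, b) \<in> parcs G" for a b
    using endo that by (auto simp: graph_endomorphism_def)
  show nonadj: "(u, v) \<notin> parcs G"
    using arc[of u v] arc_neq[of "f u" "f v"] \<open>f u = f v\<close> by auto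
  let ?S = "{u, v} \<union> (neighbours G u \<union> neighbours G v)"
  have "{u, v} \<inter> (neighbours G u \<union> neighbours G v) = {}"
    using nonadj arc_sym by (auto simp: neighbour_iff dest: arc_neq)
  then have "card ?S = 2 + card (neighbours G u \<union> neighbours G v)"
    using \<open>u \<noteq> v\<close> by (subst card_Un_disjoint) auto
  then have card_S: "card ?S + m = 2 * k + 2"
    using card_Un_neighbours[OF V] common_nonadjacent[OF V \<open>u \<noteq> v\<close> nonadj] by simp
  have "f ` ?S \<subseteq> insert (f u) (neighbours G (f u))"
    using arc \<open>f u = f v\<close> by (auto simp: neighbour_iff) (metis arc)
  then have "card (f ` ?S) \<le> card (insert (f u) (neighbours G (f u)))"
    by (intro card_mono) auto
  also have "\<dots> \<le> k + 1"
    using regular[of "f u"] endo V by (auto simp: graph_endomorphism_def card_insert_if)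
  finally have card_image: "card (f ` ?S) \<le> k + 1" .
  have "?S \<subseteq> pverts G"
    using V neighbours_subset by auto
  from card_minus_card_image_mono[OF pair_finite_verts this, of f]
  show "k + 1 + endomorphism_rank G f \<le> n + m"
    using card_S card_image card_vertices by (simp add: endomorphism_rank_def)
qed

end

theorem theorem7p2:
  fixes G :: "'a pair_pre_digraph" and f :: "'a \<Rightarrow> 'a" and n k l m r :: nat
  assumes "nontrivial_strongly_regular_graph G n k l m"
    and "proper_endomorphism G f"
    and "endomorphism_rank G f = r"
  shows "real n - real r \<ge> 1 + sqrt (real n - 1) / 12"
proof -
  interpret nontrivial_strongly_regular_graph G n k l m
    by (rule assms(1))
  have endo: "graph_endomorphism G f"
    using assms(2) by (simp add: proper_endomorphism_def)
  obtain u v where uv: "u \<in> pverts G" "v \<in> pverts G" "u \<noteq> v" "f u = f v"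
    using proper_endomorphism_not_inj[OF assms(2)] by (auto simp: inj_on_def)
  note loss = rank_loss_at_least[OF endo uv]
  define x where "x = sqrt (real n - 1)"
  have "x \<le> 4 * (real k - real m)"
    using sqrt_le_four_mul_degree_minus_common[OF uv(1-3) loss(2)] by (simp add: x_def)
  moreover have "real k + 1 + real r \<le> real n + real m"
    using loss(1) assms(3) by linarith
  moreover have "0 \<le> x"
    using degree_less[OF uv(1)] by (simp add: x_def)
  ultimately show ?thesis
    unfolding x_def[symmetric] by argo
qed

end
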